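(* Let $m=\min\{p,q\}$. Assume that there are indices $1\le j_1<\cdots<j_m\le q$ and $1\le i_1<\cdots<i_m\le p$ such that $b_{j_1},\dots,b_{j_m}$ are pairwise distinct, $\kappa_{i_1},\dots,\kappa_{i_m}$ are pairwise distinct, and $1+\kappa_{i_\beta}+b_{j_\alpha}\ne0$ for all $\alpha,\beta\in\{1,\dots,m\}$, with all involved Gamma factors finite (that is, $\kappa_i+a_\rho+1\notin\{0,-1,\dots\}$ and $\kappa_i+b_h+1\notin\{0,-1,\dots\}$ for all $i,\rho,h$). Then some $m\times m$ minor of $W$ is not identically zero. Consequently $\operatorname{rank}W(z)=m$ for every $z\in\mathbb T$ except possibly finitely many points. The same assertion (a maximal minor is not identically zero, and the rank is $m$ at all but finitely many points of $\mathbb T$) holds for the matrix $C$.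
   Context: $\mathbb T$ is the unit circle; $\mathbf 1_d$ is the all-ones vector, $\boldsymbol e_j$ the $j$-th standard basis vector of $\mathbb C^q$, and $\Gamma(\boldsymbol v)=\prod_h\Gamma(v_h)$ for a vector $\boldsymbol v$ (empty product $=1$). Integers $p,q\ge1$, $0\le r<q$; parameters $\boldsymbol a\in\mathbb C^r$, $\boldsymbol b\in\mathbb C^q$, $\boldsymbol\kappa\in\mathbb C^p$. The $q\times p$ matrix $W(z)=[w_{j,i}(z)]$ has the entire entries $$w_{j,i}(z)=\sum_{k=0}^{\infty}\frac{\Gamma((k+\kappa_i)\mathbf 1_r+\boldsymbol a+\mathbf 1_r)}{\Gamma((k+\kappa_i)\mathbf 1_q+\boldsymbol b+\boldsymbol e_j+\mathbf 1_q)}z^k,$$ and $C(z)=[C_{j,i}(z)]$ with $C_{j,i}(z)=\frac1z w_{j,i}(1/z)$, $z\ne0$. *)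

theory Defs
  imports
    "HOL-Analysis.Analysis"
    "Jordan_Normal_Form.DL_Rank"
    "Jordan_Normal_Form.DL_Submatrix"
begin

text \<open>Vectors, matrices, determinants and ranks are those of \<open>Jordan_Normal_Form\<close>, so all
  indices start at 0.\<close>

unbundle no vec_syntax
hide_const (open) Finite_Cartesian_Product.vec Finite_Cartesian_Product.mat Determinants.det

definition ones_vec :: "nat \<Rightarrow> complex vec" where
  "ones_vec d = vec d (\<lambda>_. 1)"

definition Gamma_vec :: "complex vec \<Rightarrow> complex" where
  "Gamma_vec v = (\<Prod>h<dim_vec v. Gamma (v $ h))"

text \<open>The sizes are read off from the parameters: \<open>r = dim_vec a\<close>, \<open>q = dim_vec b\<close>,
  \<open>p = dim_vec \<kappa>\<close>. The power series below is entire for \<open>r < q\<close>. The library sets \<open>Gamma\<close> to 0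
  at its poles, so the formula is meaningful only if no argument is a pole.\<close>

definition w_entry ::
    "complex vec \<Rightarrow> complex vec \<Rightarrow> complex vec \<Rightarrow> nat \<Rightarrow> nat \<Rightarrow> complex \<Rightarrow> complex" where
  "w_entry a b \<kappa> j i z =
     (\<Sum>k. Gamma_vec ((of_nat k + \<kappa> $ i) \<cdot>\<^sub>v ones_vec (dim_vec a) + a + ones_vec (dim_vec a))
         / Gamma_vec ((of_nat k + \<kappa> $ i) \<cdot>\<^sub>v ones_vec (dim_vec b) + b + unit_vec (dim_vec b) j
                        + ones_vec (dim_vec b))
         * z ^ k)"

definition W_mat :: "complex vec \<Rightarrow> complex vec \<Rightarrow> complex vec \<Rightarrow> complex \<Rightarrow> complex mat" where
  "W_mat a b \<kappa> z = mat (dim_vec b) (dim_vec \<kappa>) (\<lambda>(j, i). w_entry a b \<kappa> j i z)"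

text \<open>Only used for \<open>z \<noteq> 0\<close>.\<close>

definition C_mat :: "complex vec \<Rightarrow> complex vec \<Rightarrow> complex vec \<Rightarrow> complex \<Rightarrow> complex mat" where
  "C_mat a b \<kappa> z = mat (dim_vec b) (dim_vec \<kappa>) (\<lambda>(j, i). 1 / z * w_entry a b \<kappa> j i (1 / z))"

end

theory Submission
  imports
    "HOL-Complex_Analysis.Conformal_Mappings"
    "Jordan_Normal_Form.DL_Rank_Submatrix"
    Defs
begin

text \<open>At \<open>z = 0\<close> only the constant terms survive, and the functional equation of Gamma turns the minor
  with rows \<open>js\<close> and columns \<open>is\<close> into a Cauchy determinant with entries
  \<open>1 / (b\<^sub>j + \<kappa>\<^sub>i + 1)\<close>, up to nonzero column factors. So this minor is nonzero at 0; being an entire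
  function of \<open>z\<close>, it has only finitely many zeros on the unit circle. The matrix \<open>C(z)\<close> equals
  \<open>W(1/z) / z\<close>, and \<open>z \<mapsto> 1/z\<close> preserves the circle.\<close>

unbundle no vec_syntax

section \<open>Cauchy determinants with scaled columns\<close>

text \<open>A kernel vector \<open>v\<close> gives the rational function \<open>t\<close> \<mapsto>
  sum of \<open>c j * v $ j / (t + y j)\<close>, which vanishes at all \<open>x i\<close>. Its
  numerator has degree below \<open>n\<close> but \<open>n\<close> distinct roots, so it is zero,
  and its values at the points \<open>- y j\<close> force \<open>v\<close> to vanish.\<close>

lemma det_column_scaled_cauchy:
  fixes x y c :: "nat \<Rightarrow> 'a :: field"
  assumes x: "inj_on x {..<n}" and y: "inj_on y {..<n}"
    and nz: "\<And>i j. i < n \<Longrightarrow> j < n \<Longrightarrow> x i + y j \<noteq> 0"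
    and c: "\<And>j. j < n \<Longrightarrow> c j \<noteq> 0"
  shows "det (mat n n (\<lambda>(i, j). c j / (x i + y j))) \<noteq> 0"
proof
  define A where "A = mat n n (\<lambda>(i, j). c j / (x i + y j))"
  have A: "A \<in> carrier_mat n n" by (simp add: A_def)
  assume "det (mat n n (\<lambda>(i, j). c j / (x i + y j))) = 0"
  then obtain v where v: "v \<in> carrier_vec n" "v \<noteq> 0\<^sub>v n" "A *\<^sub>v v = 0\<^sub>v n"
    using det_0_iff_vec_prod_zero_field[OF A] by (auto simp: A_def)
  \<comment> \<open>Row \<open>i\<close> of \<open>A v = 0\<close>, cleared of denominators, says that \<open>x i\<close> is a root of \<open>P\<close>.\<close>
  define P where "P = (\<Sum>j<n. Polynomial.smult (v $ j * c j) (\<Prod>l\<in>{..<n} - {j}. [:y l, 1:]))"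
  have poly_P: "poly P t = (\<Sum>j<n. v $ j * c j * (\<Prod>l\<in>{..<n} - {j}. t + y l))" for t
    by (simp add: P_def poly_sum poly_prod add.commute)
  have root: "poly P (x i) = 0" if "i < n" for i
  proof -
    have "0 = (A *\<^sub>v v) $ i" using that v by simp
    also have "\<dots> = (\<Sum>j<n. c j / (x i + y j) * v $ j)"
      using that v(1) by (simp add: A_def scalar_prod_def lessThan_atLeast0)
    finally have "0 = (\<Sum>j<n. c j / (x i + y j) * v $ j) * (\<Prod>l<n. x i + y l)" by simp
    also have "\<dots> = poly P (x i)"
      unfolding poly_P sum_distrib_right
    proof (rule sum.cong)
      fix j assume j: "j \<in> {..<n}"
      have "(\<Prod>l<n. x i + y l) = (x i + y j) * (\<Prod>l\<in>{..<n} - {j}. x i + y l)"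
        using j by (simp add: prod.remove)
      then show "c j / (x i + y j) * v $ j * (\<Prod>l<n. x i + y l)
          = v $ j * c j * (\<Prod>l\<in>{..<n} - {j}. x i + y l)"
        using nz[OF that, of j] j by simp
    qed simp
    finally show ?thesis by simp
  qed
  have "P = 0"
  proof (rule ccontr)
    assume "P \<noteq> 0"
    have "degree P < n"
    proof (cases "n = 0")
      \<comment> \<open>The degree bound \<open>n - 1\<close> is below \<open>n\<close> only for
        positive \<open>n\<close>; for \<open>n = 0\<close> the empty sum gives
        \<open>P = 0\<close>.\<close>
      case True
      then show ?thesis using \<open>P \<noteq> 0\<close> by (simp add: P_def)
    next
      case False
      have "degree P \<le> n - 1"
        unfolding P_def
      proof (rule degree_sum_le)
        fix j assume "j \<in> {..<n}"
        have "degree (\<Prod>l\<in>{..<n} - {j}. [:y l, 1:]) \<le> (\<Sum>l\<in>{..<n} - {j}. degree [:y l, 1:])"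
          using degree_prod_sum_le[of "{..<n} - {j}" "\<lambda>l. [:y l, 1:]"] by (simp add: o_def)
        also have "\<dots> = n - 1" using \<open>j \<in> {..<n}\<close> by simp
        finally show "degree (Polynomial.smult (v $ j * c j) (\<Prod>l\<in>{..<n} - {j}. [:y l, 1:])) \<le> n - 1"
          using degree_smult_le order_trans by blast
      qed simp
      with False show ?thesis by simp
    qed
    moreover have "n \<le> card {t. poly P t = 0}"
      using card_mono[OF poly_roots_finite[OF \<open>P \<noteq> 0\<close>], of "x ` {..<n}"] root
      by (auto simp: card_image[OF x])
    ultimately show False using card_poly_roots_bound[OF \<open>P \<noteq> 0\<close>] by simp
  qed
  have "v $ j = 0" if j: "j < n" for j
  proof -
    have "0 = poly P (- y j)" using \<open>P = 0\<close> by simp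
    \<comment> \<open>At \<open>- y j\<close> every summand of index other than \<open>j\<close>
      contains the factor \<open>- y j + y j\<close>; the surviving product is nonzero by
      distinctness of the \<open>y l\<close>.\<close>
    also have "\<dots> = (\<Sum>i\<in>{j}. v $ i * c i * (\<Prod>l\<in>{..<n} - {i}. - y j + y l))"
      unfolding poly_P using j by (intro sum.mono_neutral_right) auto
    finally have "v $ j * c j * (\<Prod>l\<in>{..<n} - {j}. - y j + y l) = 0" by simp
    moreover have "(\<Prod>l\<in>{..<n} - {j}. - y j + y l) \<noteq> 0"
      using j inj_onD[OF y, of _ j] by auto
    ultimately show ?thesis using c[OF j] by simp
  qed
  with v(1,2) show False by auto
qed

section \<open>Convergence of the series and the entries of \<open>W_mat\<close>\<close>

text \<open>These are the limits of the factors in the ratio of consecutive series terms. The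
  quotient is 1 plus \<open>(u - v) / (of_nat k + v)\<close> once the denominator is nonzero, which
  holds for large \<open>k\<close>.\<close>

lemma tendsto_shift_quotient:
  fixes u v :: complex
  shows "(\<lambda>k. (of_nat k + u) / (of_nat k + v)) \<longlonglongrightarrow> 1"
    and tendsto_inverse_shift: "(\<lambda>k. 1 / (of_nat k + v)) \<longlonglongrightarrow> 0"
proof -
  have lim: "filterlim (\<lambda>k. of_nat k + v) at_infinity sequentially"
    by (rule tendsto_add_filterlim_at_infinity'[OF tendsto_of_nat tendsto_const])
  show 0: "(\<lambda>k. 1 / (of_nat k + v)) \<longlonglongrightarrow> 0"
    by (rule tendsto_divide_0[OF tendsto_const lim])
  have "\<forall>\<^sub>F k in sequentially. of_nat k + v \<noteq> 0"
    using filterlim_at_infinity_imp_eventually_ne[OF lim] .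
  then have "\<forall>\<^sub>F k in sequentially.
      1 + (u - v) * (1 / (of_nat k + v)) = (of_nat k + u) / (of_nat k + v)"
    by eventually_elim (simp add: divide_simps)
  moreover have "(\<lambda>k. 1 + (u - v) * (1 / (of_nat k + v))) \<longlonglongrightarrow> 1"
    by (rule tendsto_eq_intros 0 refl | simp)+
  ultimately show "(\<lambda>k. (of_nat k + u) / (of_nat k + v)) \<longlonglongrightarrow> 1"
    using tendsto_cong by fast
qed

lemma of_nat_add_notin_nonpos_Ints:
  "of_nat k + (z :: 'a :: ring_char_0) \<notin> \<int>\<^sub>\<le>\<^sub>0" if "z \<notin> \<int>\<^sub>\<le>\<^sub>0"
  using that nonpos_Ints_diff_Nats[of "of_nat k + z" "of_nat k"] by auto

text \<open>Ratio test: \<open>Gamma (w + 1) = w * Gamma w\<close> makes the ratio of consecutive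
  terms rational in \<open>k\<close>. Pairing the \<open>r\<close> numerator factors with
  \<open>r\<close> denominator factors gives quotients tending to 1, and the remaining
  \<open>q - r > 0\<close> factors tend to 0.\<close>

lemma summable_Gamma_quotient:
  fixes u v :: "nat \<Rightarrow> complex"
  assumes "r < q"
    and u: "\<And>h. h < r \<Longrightarrow> u h \<notin> \<int>\<^sub>\<le>\<^sub>0" and v: "\<And>h. h < q \<Longrightarrow> v h \<notin> \<int>\<^sub>\<le>\<^sub>0"
  shows "summable (\<lambda>k. (\<Prod>h<r. Gamma (of_nat k + u h)) / (\<Prod>h<q. Gamma (of_nat k + v h)) * z ^ k)"
    (is "summable ?f")
proof -
  define g where "g = (\<lambda>k. z * ((\<Prod>h<r. (of_nat k + u h) / (of_nat k + v h))
    * (\<Prod>h\<in>{r..<q}. 1 / (of_nat k + v h))))"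
  have split: "{..<q} = {..<r} \<union> {r..<q}" using \<open>r < q\<close> by auto
  have "g \<longlonglongrightarrow> z * ((\<Prod>h<r. 1) * (\<Prod>h\<in>{r..<q}. 0))"
    unfolding g_def
    by (intro tendsto_mult tendsto_const tendsto_prod tendsto_shift_quotient tendsto_inverse_shift)
  then have "g \<longlonglongrightarrow> 0" using \<open>r < q\<close> by (simp add: power_0_left)
  \<comment> \<open>Any constant strictly between 0 and 1 would serve as the ratio.\<close>
  then have "\<forall>\<^sub>F k in sequentially. norm (g k) < 1 / 2"
    by (rule order_tendstoD(2)[OF tendsto_norm_zero]) simp
  then obtain N where N: "\<And>k. k \<ge> N \<Longrightarrow> norm (g k) < 1 / 2"
    by (auto simp: eventually_sequentially)
  have step: "?f (Suc k) = g k * ?f k" for k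
  proof -
    have G: "Gamma (of_nat (Suc k) + w) = (of_nat k + w) * Gamma (of_nat k + w)"
      if "w \<notin> \<int>\<^sub>\<le>\<^sub>0" for w :: complex
      using Gamma_plus1[OF of_nat_add_notin_nonpos_Ints[OF that, of k]] by (simp add: add_ac)
    have A: "(\<Prod>h<r. Gamma (of_nat (Suc k) + u h)) / (\<Prod>h<q. Gamma (of_nat (Suc k) + v h))
       = ((\<Prod>h<r. of_nat k + u h) / (\<Prod>h<q. of_nat k + v h))
         * ((\<Prod>h<r. Gamma (of_nat k + u h)) / (\<Prod>h<q. Gamma (of_nat k + v h)))"
      using u v by (simp add: G prod.distrib del: of_nat_Suc)
    have B: "g k = z * ((\<Prod>h<r. of_nat k + u h) / (\<Prod>h<q. of_nat k + v h))"
      unfolding g_def split by (subst prod.union_disjoint) (auto simp: prod_dividef)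
    show ?thesis unfolding A B by (simp add: mult_ac)
  qed
  show ?thesis
  proof (rule summable_ratio_test)
    fix k assume "N \<le> k"
    then show "norm (?f (Suc k)) \<le> 1 / 2 * norm (?f k)"
      unfolding step norm_mult[of "g k"] using N[of k] by (intro mult_right_mono) auto
  qed simp
qed

text \<open>Brings every Gamma argument into the form \<open>of_nat k\<close> plus a constant, as
  the summability lemma expects; the unit vector shifts only the factor
  \<open>h = j\<close>.\<close>

lemma w_entry_eq:
  assumes "j < dim_vec b"
  shows "w_entry a b \<kappa> j i z =
    (\<Sum>k. (\<Prod>h<dim_vec a. Gamma (of_nat k + (\<kappa> $ i + a $ h + 1)))
       / (\<Prod>h<dim_vec b. Gamma (of_nat k + (\<kappa> $ i + b $ h + 1 + (if h = j then 1 else 0)))) * z ^ k)"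
  unfolding w_entry_def Gamma_vec_def ones_vec_def
  by (intro suminf_cong arg_cong2[of _ _ _ _ "(*)"] arg_cong2[of _ _ _ _ "(/)"] prod.cong refl)
    (use assms in \<open>auto simp: add_ac unit_vec_def\<close>)

lemma w_entry_holomorphic:
  assumes "j < dim_vec b" and "dim_vec a < dim_vec b"
    and "\<And>h. h < dim_vec a \<Longrightarrow> \<kappa> $ i + a $ h + 1 \<notin> \<int>\<^sub>\<le>\<^sub>0"
    and b: "\<And>h. h < dim_vec b \<Longrightarrow> \<kappa> $ i + b $ h + 1 \<notin> \<int>\<^sub>\<le>\<^sub>0"
  shows "w_entry a b \<kappa> j i holomorphic_on UNIV"
proof -
  \<comment> \<open>Raising the argument at \<open>h = j\<close> by 1 cannot produce a pole.\<close>
  have "\<kappa> $ i + b $ h + 1 + (if h = j then 1 else 0) \<notin> \<int>\<^sub>\<le>\<^sub>0" if "h < dim_vec b" for h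
    using of_nat_add_notin_nonpos_Ints[OF b[OF that], of 1] b[OF that] by (cases "h = j") (simp_all add: add_ac)
  then have "summable (\<lambda>k. (\<Prod>h<dim_vec a. Gamma (of_nat k + (\<kappa> $ i + a $ h + 1)))
      / (\<Prod>h<dim_vec b. Gamma (of_nat k + (\<kappa> $ i + b $ h + 1 + (if h = j then 1 else 0)))) * y ^ k)"
    for y
    using assms(2,3)
    by (intro summable_Gamma_quotient[where u = "\<lambda>h. \<kappa> $ i + a $ h + 1"
          and v = "\<lambda>h. \<kappa> $ i + b $ h + 1 + (if h = j then 1 else 0)"])
  from termdiffs_strong_converges_everywhere[OF this] show ?thesis
    unfolding w_entry_eq[OF assms(1), abs_def] holomorphic_on_open[OF open_UNIV] by blast
qed

text \<open>\<open>Gamma_plus1\<close> extracts the shift of factor \<open>j\<close>. What remains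
  depends only on the column \<open>i\<close>, and the last denominator is written as a row term
  plus a column term to match the Cauchy form.\<close>

lemma w_entry_0:
  assumes "j < dim_vec b" and "\<kappa> $ i + b $ j + 1 \<notin> \<int>\<^sub>\<le>\<^sub>0"
  shows "w_entry a b \<kappa> j i 0 =
    (\<Prod>h<dim_vec a. Gamma (\<kappa> $ i + a $ h + 1)) / (\<Prod>h<dim_vec b. Gamma (\<kappa> $ i + b $ h + 1))
      / (b $ j + (\<kappa> $ i + 1))"
proof -
  have *: "(\<Prod>h<dim_vec b. Gamma (\<kappa> $ i + b $ h + 1 + (if h = j then 1 else 0)))
     = (\<Prod>h<dim_vec b. Gamma (\<kappa> $ i + b $ h + 1)) * (b $ j + (\<kappa> $ i + 1))"
    using assms Gamma_plus1[OF assms(2)]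
    by (simp add: prod.remove[of _ j] mult_ac add_ac)
  show ?thesis
    unfolding w_entry_eq[OF assms(1)] powser_zero by (simp add: *)
qed

section \<open>Holomorphic determinants and zeros on the circle\<close>

lemma holomorphic_on_det:
  assumes "\<And>z. A z \<in> carrier_mat n n"
    and "\<And>i j. i < n \<Longrightarrow> j < n \<Longrightarrow> (\<lambda>z. A z $$ (i, j)) holomorphic_on S"
  shows "(\<lambda>z. det (A z)) holomorphic_on S"
proof -
  have "(\<lambda>z. \<Sum>\<pi> | \<pi> permutes {0..<n}. signof \<pi> * (\<Prod>i = 0..<n. A z $$ (i, \<pi> i)))
      holomorphic_on S"
    using assms(2) by (intro holomorphic_intros) (auto simp: permutes_in_image)
  then show ?thesis by (simp add: det_def'[OF assms(1)])
qed

text \<open>The circle is compact, so zeros of a nonconstant entire function cannot accumulate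
  there; a constant function is nonzero because of \<open>w\<close>.\<close>

lemma finite_zeros_on_sphere:
  assumes f: "f holomorphic_on UNIV" and "f w \<noteq> 0"
  shows "finite {z \<in> sphere 0 1. f z = 0}"
proof (cases "f constant_on UNIV")
  case True
  then have "f z \<noteq> 0" for z using \<open>f w \<noteq> 0\<close> by (metis UNIV_I constant_on_def)
  then show ?thesis by simp
next
  case False
  then show ?thesis using f by (intro holomorphic_compact_finite_zeros) auto
qed


section \<open>Ranks and maximal minors\<close>

lemma (in vec_space) rank_le_nr:
  assumes "A \<in> carrier_mat n nc"
  shows "rank A \<le> n"
proof -
  obtain S where S: "maximal S (\<lambda>T. T \<subseteq> set (cols A) \<and> lin_indpt T)"
    using maximal_exists[of "\<lambda>T. T \<subseteq> set (cols A) \<and> lin_indpt T" "card (set (cols A))" "{}"]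
    by (meson List.finite_set card_mono empty_iff empty_subsetI finite_lin_indpt2 rev_finite_subset)
  have "set (cols A) \<subseteq> carrier_vec n" using cols_dim assms by blast
  moreover have "S \<subseteq> set (cols A)" "lin_indpt S"
    using S unfolding maximal_def by blast+
  ultimately have "card S \<le> n" using li_le_dim(2)[OF fin_dim] dim_is_n by simp
  then show ?thesis using rank_card_indpt[OF assms S] by simp
qed

text \<open>The minor bounds the rank from below, both dimensions bound it from above. Since
  \<open>det\<close> is 0 on non-square matrices, the last hypothesis also forces the selected
  submatrix to be square.\<close>

lemma (in vec_space) rank_eq_min_if_minor:
  assumes A: "A \<in> carrier_mat n nc" and "I \<subseteq> {..<nc}" and "card I = min nc n"
    and "det (submatrix A J I) \<noteq> 0"
  shows "rank A = min nc n"
proof -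
  have "{j. j < nc \<and> j \<in> I} = I" using \<open>I \<subseteq> {..<nc}\<close> by auto
  then show ?thesis
    using rank_gt_minor[OF A assms(4)] assms(3) rank_le_nc[OF A] rank_le_nr[OF A] by simp
qed

lemma submatrix_mat:
  assumes "J \<subseteq> {..<nr}" and "I \<subseteq> {..<nc}"
  shows "submatrix (mat nr nc f) J I
    = mat (card J) (card I) (\<lambda>(i, j). f (pick J i, pick I j))"
proof -
  have eq: "{i. i < nr \<and> i \<in> J} = J" "{i. i < nc \<and> i \<in> I} = I" using assms by auto
  have "pick J i < nr" if "i < card J" for i using pick_le[of i nr J] that eq by simp
  moreover have "pick I i < nc" if "i < card I" for i using pick_le[of i nc I] that eq by simp
  ultimately show ?thesis by (intro eq_matI) (auto simp: submatrix_def eq)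
qed

lemma inj_on_pick: "inj_on (pick S) {..<card S}"
  by (rule linorder_inj_onI) (auto dest: pick_mono_le)

section \<open>The chosen minor and the exceptional points\<close>

theorem proposition3p8:
  fixes p q r m :: nat and a b \<kappa> :: "complex vec" and js "is" :: "nat \<Rightarrow> nat"
  assumes "p \<ge> 1" and "q \<ge> 1" and "r < q"
    and "a \<in> carrier_vec r" and "b \<in> carrier_vec q" and "\<kappa> \<in> carrier_vec p"
    and "m = min p q"
    and "strict_mono_on {..<m} js" and "js ` {..<m} \<subseteq> {..<q}"
    and "strict_mono_on {..<m} is" and "is ` {..<m} \<subseteq> {..<p}"
    and "inj_on (\<lambda>\<alpha>. b $ js \<alpha>) {..<m}"
    and "inj_on (\<lambda>\<beta>. \<kappa> $ is \<beta>) {..<m}"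
    and "\<And>\<alpha> \<beta>. \<alpha> < m \<Longrightarrow> \<beta> < m \<Longrightarrow> 1 + \<kappa> $ is \<beta> + b $ js \<alpha> \<noteq> 0"
    and "\<And>i \<rho>. i < p \<Longrightarrow> \<rho> < r \<Longrightarrow> \<kappa> $ i + a $ \<rho> + 1 \<notin> \<int>\<^sub>\<le>\<^sub>0"
    and "\<And>i h. i < p \<Longrightarrow> h < q \<Longrightarrow> \<kappa> $ i + b $ h + 1 \<notin> \<int>\<^sub>\<le>\<^sub>0"
  shows "(\<exists>J I. J \<subseteq> {..<q} \<and> card J = m \<and> I \<subseteq> {..<p} \<and> card I = m \<and>
            (\<exists>z. det (submatrix (W_mat a b \<kappa> z) J I) \<noteq> 0)) \<and>
         finite {z \<in> sphere 0 1. vec_space.rank q (W_mat a b \<kappa> z) \<noteq> m} \<and>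
         (\<exists>J I. J \<subseteq> {..<q} \<and> card J = m \<and> I \<subseteq> {..<p} \<and> card I = m \<and>
            (\<exists>z. z \<noteq> 0 \<and> det (submatrix (C_mat a b \<kappa> z) J I) \<noteq> 0)) \<and>
         finite {z \<in> sphere 0 1. vec_space.rank q (C_mat a b \<kappa> z) \<noteq> m}"
proof -
  have dims: "dim_vec a = r" "dim_vec b = q" "dim_vec \<kappa> = p" using assms(4-6) by auto
  note a_ok = assms(15) and b_ok = assms(16)
  \<comment> \<open>\<open>submatrix\<close> takes index sets and enumerates them by
    \<open>pick\<close>, so the distinctness assumptions are carried over from the sequences to
    \<open>pick J\<close> and \<open>pick I\<close>.\<close>
  define J where "J = js ` {..<m}"
  define I where "I = is ` {..<m}"
  have J: "J \<subseteq> {..<q}" "card J = m" and I: "I \<subseteq> {..<p}" "card I = m"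
    using assms(8-11) by (auto simp: J_def I_def card_image strict_mono_on_imp_inj_on)
  have pick_J: "pick J \<alpha> \<in> J" "pick J \<alpha> < q" if "\<alpha> < m" for \<alpha>
    using pick_in_set_le[of \<alpha> J] J that by auto
  have pick_I: "pick I \<beta> \<in> I" "pick I \<beta> < p" if "\<beta> < m" for \<beta>
    using pick_in_set_le[of \<beta> I] I that by auto
  have "inj_on (vec_index b) J" "inj_on (vec_index \<kappa>) I"
    using assms(12,13) by (auto simp: J_def I_def intro: inj_on_imageI simp: comp_def)
  then have inj_b: "inj_on (\<lambda>\<alpha>. b $ pick J \<alpha>) {..<m}"
    and inj_\<kappa>: "inj_on (\<lambda>\<beta>. \<kappa> $ pick I \<beta> + 1) {..<m}"
    using inj_on_pick[of J] inj_on_pick[of I] pick_J(1) pick_I(1) J(2) I(2)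
    by (auto simp: inj_on_def)
  define D where "D z = det (submatrix (W_mat a b \<kappa> z) J I)" for z
  have sub_W: "submatrix (W_mat a b \<kappa> z) J I
      = mat m m (\<lambda>(\<alpha>, \<beta>). w_entry a b \<kappa> (pick J \<alpha>) (pick I \<beta>) z)" for z
    by (simp add: W_mat_def dims submatrix_mat J I)
  \<comment> \<open>Each of the \<open>m\<close> rows contributes one factor \<open>1 / z\<close> to
    the determinant.\<close>
  have "submatrix (C_mat a b \<kappa> z) J I = (1 / z) \<cdot>\<^sub>m submatrix (W_mat a b \<kappa> (1 / z)) J I" for z
    unfolding sub_W by (auto simp: C_mat_def dims submatrix_mat J I)
  then have det_C: "det (submatrix (C_mat a b \<kappa> z) J I) = (1 / z) ^ m * D (1 / z)" for z
    unfolding D_def by (simp add: sub_W)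

  have "D 0 \<noteq> 0"
  proof -
    define c where "c i = (\<Prod>h<r. Gamma (\<kappa> $ i + a $ h + 1)) / (\<Prod>h<q. Gamma (\<kappa> $ i + b $ h + 1))" for i
    have "submatrix (W_mat a b \<kappa> 0) J I
        = mat m m (\<lambda>(\<alpha>, \<beta>). c (pick I \<beta>) / (b $ pick J \<alpha> + (\<kappa> $ pick I \<beta> + 1)))"
      unfolding sub_W by (rule cong_mat) (auto simp: w_entry_0 b_ok pick_J pick_I dims c_def)
    \<comment> \<open>Gamma has no zeros away from its poles, so numerator and denominator of
      \<open>c\<close> are nonzero.\<close>
    moreover have "c (pick I \<beta>) \<noteq> 0" if "\<beta> < m" for \<beta>
      using a_ok[OF pick_I(2)[OF that]] b_ok[OF pick_I(2)[OF that]]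
      by (auto simp: c_def Gamma_eq_zero_iff)
    moreover have "b $ pick J \<alpha> + (\<kappa> $ pick I \<beta> + 1) \<noteq> 0" if "\<alpha> < m" "\<beta> < m" for \<alpha> \<beta>
      using b_ok[OF pick_I(2)[OF that(2)] pick_J(2)[OF that(1)]]
      by (metis add.assoc add.commute zero_in_nonpos_Ints)
    ultimately show ?thesis
      unfolding D_def using det_column_scaled_cauchy[OF inj_b inj_\<kappa>] by simp
  qed

  have D_hol: "D holomorphic_on UNIV"
    unfolding D_def sub_W
    by (rule holomorphic_on_det)
      (auto simp: dims pick_J pick_I \<open>r < q\<close> a_ok b_ok intro!: w_entry_holomorphic)
  have fin: "finite {z \<in> sphere 0 1. D z = 0}"
    by (rule finite_zeros_on_sphere[OF D_hol \<open>D 0 \<noteq> 0\<close>])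
  \<comment> \<open>The point 0 is not \<open>1 / z\<close> for any nonzero \<open>z\<close>, so the
    minor of \<open>C_mat\<close> needs a point near 0 where \<open>D\<close> is still
    nonzero.\<close>
  have "isCont D 0"
    using D_hol holomorphic_on_imp_continuous_on continuous_on_eq_continuous_at by blast
  then obtain e where "e > 0" and e: "\<And>z. dist 0 z < e \<Longrightarrow> D z \<noteq> 0"
    using continuous_at_avoid[of 0 D 0] \<open>D 0 \<noteq> 0\<close> by auto
  \<comment> \<open>Chosen so that \<open>1 / z0\<close> has norm \<open>e / 2 < e\<close>.\<close>
  define z0 where "z0 = complex_of_real (2 / e)"
  have "z0 \<noteq> 0" "D (1 / z0) \<noteq> 0"
    using \<open>e > 0\<close> by (auto simp: z0_def norm_divide intro!: e)
  then have det_C0: "det (submatrix (C_mat a b \<kappa> z0) J I) \<noteq> 0" by (simp add: det_C)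

  have W_rank: "vec_space.rank q (W_mat a b \<kappa> z) = m" if "D z \<noteq> 0" for z
    using that I vec_space.rank_eq_min_if_minor[of "W_mat a b \<kappa> z" q p I J]
    by (simp add: D_def W_mat_def dims \<open>m = min p q\<close>)
  have C_rank: "vec_space.rank q (C_mat a b \<kappa> z) = m" if "D (1 / z) \<noteq> 0" "z \<noteq> 0" for z
    using that I vec_space.rank_eq_min_if_minor[of "C_mat a b \<kappa> z" q p I J] det_C[of z]
    by (simp add: C_mat_def dims \<open>m = min p q\<close>)
  have "finite {z \<in> sphere 0 1. vec_space.rank q (W_mat a b \<kappa> z) \<noteq> m}"
    by (rule finite_subset[OF _ fin]) (use W_rank in auto)
  moreover have "finite {z \<in> sphere 0 1. vec_space.rank q (C_mat a b \<kappa> z) \<noteq> m}"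
  \<comment> \<open>Inversion preserves the circle and is its own inverse, so the exceptional points
    of \<open>C_mat\<close> lie in the image of the zeros of \<open>D\<close>.\<close>
  proof (rule finite_subset[OF _ finite_imageI[OF fin, of "\<lambda>z. 1 / z"]], rule subsetI)
    fix z assume z: "z \<in> {z \<in> sphere 0 1. vec_space.rank q (C_mat a b \<kappa> z) \<noteq> m}"
    then have "1 / z \<in> {z \<in> sphere 0 1. D z = 0}"
      using C_rank[of z] by (cases "z = 0") (auto simp: norm_divide)
    then show "z \<in> (\<lambda>z. 1 / z) ` {z \<in> sphere 0 1. D z = 0}" by (rule rev_image_eqI) simp
  qed
  ultimately show ?thesis using J I \<open>D 0 \<noteq> 0\<close> \<open>z0 \<noteq> 0\<close> det_C0 unfolding D_def by blast
qed

end
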